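(* Let $N,n$ be positive integers with $n<N$ and let $b$ be a real non-integer parameter. Then the relation $$(1-x)^b\,{}_2F_1\!\left({-n,\,b\atop -N};x\right)={}_2F_1\!\left({n-N,\,b\atop -N};\frac{x}{x-1}\right)$$ holds term by term as an identity between power series in $x$ up to and including the monomial $x^N$; that is, the power series expansions of both sides at $x=0$ have the same coefficients of $x^k$ for all $0\le k\le N$.
   Context: $(a)_k=a(a+1)\cdots(a+k-1)$. For an integer $0\le n\le N$, ${}_2F_1(-n,c;-N;z)$ denotes the polynomial $\sum_{k=0}^{n}\frac{(-n)_k(c)_k}{(-N)_k\,k!}z^k$ (so ${}_2F_1(n-N,c;-N;z)$ is the analogous sum over $0\le k\le N-n$). $(1-x)^b=\sum_{s\ge0}\frac{(-b)_s}{s!}x^s$. *)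

theory Defs
  imports "HOL-Computational_Algebra.Computational_Algebra"
begin

text \<open>
  The terminating series \<open>\<^sub>2F\<^sub>1(-n, c; -N; z)\<close> as a polynomial in \<open>z\<close>, meant for \<open>n \<le> N\<close>, where
  no denominator vanishes. The sum is cut off at \<open>k = n\<close>, so for \<open>n \<le> N\<close> the series
  \<open>\<^sub>2F\<^sub>1(n - N, c; -N; z)\<close> is \<open>hyp2F1_poly (N - n) c N\<close>.
\<close>

definition hyp2F1_poly :: "nat \<Rightarrow> real \<Rightarrow> nat \<Rightarrow> real poly" where
  "hyp2F1_poly n c N =
     (\<Sum>k\<le>n. monom (pochhammer (- real n) k * pochhammer c k /
                    (pochhammer (- real N) k * fact k)) k)"

definition fps_one_minus_powr :: "real \<Rightarrow> real fps" where
  "fps_one_minus_powr b = Abs_fps (\<lambda>s. pochhammer (- b) s / fact s)"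

lemma fps_one_minus_powr_eq_binomial:
  "fps_one_minus_powr b = fps_compose (fps_binomial b) (- fps_X)"
  by (rule fps_ext)
     (simp add: fps_one_minus_powr_def fps_compose_uminus' gbinomial_pochhammer)

lemma fps_X_div_X_minus_1:
  "(fps_X / (fps_X - 1) :: real fps) * (fps_X - 1) = fps_X"
proof -
  have "is_unit (fps_X - 1 :: real fps)"
    by (simp add: fps_is_unit_iff)
  then show ?thesis
    by (simp add: unit_imp_dvd)
qed

end

theory Submission
  imports Defs
begin

text \<open>
  Write \<open>y = x / (x - 1)\<close>. By the Chu-Vandermonde identity,
  \<open>(n - N)\<^sub>j / (-N)\<^sub>j = \<Sum>\<^sub>i (-1)\<^sup>i (j choose i) (-n)\<^sub>i / (-N)\<^sub>i\<close> for \<open>j \<le> N\<close>. Inserting this on the right-hand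
  side and interchanging the sums reduces the claim to
  \<open>\<Sum>\<^sub>j (b)\<^sub>j / j! (j choose i) y\<^sup>j = (b)\<^sub>i / i! (-x)\<^sup>i (1 - x)\<^sup>b\<close>, whose coefficients are compared by a second
  application of Vandermonde. Only \<open>j \<le> k \<le> N\<close> contribute to the coefficient of \<open>x\<^sup>k\<close>, so no
  \<open>(-N)\<^sub>j\<close> vanishes.
\<close>

text \<open>Beyond the cut-off, \<open>pochhammer (- real n) k\<close> vanishes, so a single formula
  covers every \<open>k\<close>.\<close>

lemma coeff_hyp2F1_poly:
  "coeff (hyp2F1_poly n c N) k =
     pochhammer (- real n) k * pochhammer c k / (pochhammer (- real N) k * fact k)"
  by (cases "k \<le> n")
    (simp_all add: hyp2F1_poly_def coeff_sum pochhammer_of_nat_eq_0_lemma)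

lemma fps_X_div_X_minus_1_eq: "(fps_X / (fps_X - 1) :: real fps) = - fps_X * inverse (1 - fps_X)"
proof -
  have "- fps_X * inverse (1 - fps_X) * (fps_X - 1) =
      fps_X * ((1 - fps_X) * inverse (1 - fps_X) :: real fps)"
    by (simp add: algebra_simps)
  also have "(1 - fps_X) * inverse (1 - fps_X) = (1 :: real fps)"
    by (rule inverse_mult_eq_1') simp
  finally have "- fps_X * inverse (1 - fps_X) * (fps_X - 1) = (fps_X :: real fps)"
    by simp
  moreover have "(fps_X - 1 :: real fps) \<noteq> 0"
    by (metis fps_X_neq_one right_minus_eq)
  ultimately show ?thesis
    using fps_X_div_X_minus_1 by (metis mult_right_cancel)
qed

text \<open>Expand \<open>(-x)^j (1 - x)^(-j)\<close> by the binomial series. The coefficient is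
  written with the upper index \<open>k - 1\<close>, which is free of \<open>j\<close>, so that a
  sum over \<open>j\<close> can become a Vandermonde convolution.\<close>

lemma fps_nth_X_div_X_minus_1_power:
  assumes "j \<le> k"
  shows "((fps_X / (fps_X - 1)) ^ j :: real fps) $ k = (-1) ^ j * ((real k - 1) gchoose (k - j))"
proof -
  have "(inverse (1 - fps_X) ^ j :: real fps) = fps_compose (fps_binomial (- real j)) (- fps_X)"
    using one_minus_fps_X_const_neg_power[of "1::real" j]
    by (simp add: fps_inverse_power fps_const_neg[symmetric] del: fps_const_neg)
  then have inv: "(inverse (1 - fps_X) ^ j :: real fps) $ m = pochhammer (real j) m / fact m" for m
    by (simp add: fps_compose_uminus' gbinomial_pochhammer)
  have "((fps_X / (fps_X - 1)) ^ j :: real fps) =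
      fps_const ((-1) ^ j) * (fps_X ^ j * inverse (1 - fps_X) ^ j)"
    unfolding fps_X_div_X_minus_1_eq power_mult_distrib
    by (subst power_minus) (simp add: mult.assoc fps_const_power[symmetric]
        fps_const_neg[symmetric] del: fps_const_power fps_const_neg)
  then have "((fps_X / (fps_X - 1)) ^ j :: real fps) $ k =
      (-1) ^ j * (pochhammer (real j) (k - j) / fact (k - j))"
    using assms by (simp add: fps_X_power_mult_nth inv)
  \<comment> \<open>A rising factorial of length \<open>m\<close> from \<open>j\<close> is a falling
    one from \<open>j + m - 1\<close>, which is \<open>k - 1\<close> for
    \<open>m = k - j\<close>.\<close>
  also have "pochhammer (real j) (k - j) / fact (k - j) = (real k - 1) gchoose (k - j)"
    using assms by (simp add: gbinomial_pochhammer' of_nat_diff)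
  finally show ?thesis .
qed

lemma pochhammer_diff_div_pochhammer:
  fixes N n j :: nat
  assumes "n \<le> N" "j \<le> N"
  shows "pochhammer (- real (N - n)) j / pochhammer (- real N) j =
    (\<Sum>i\<le>j. (-1) ^ i * real (j choose i) * (pochhammer (- real n) i / pochhammer (- real N) i))"
proof -
  \<comment> \<open>Since \<open>j \<le> N\<close>, no denominator in the Chu-Vandermonde sum is
    zero.\<close>
  have "\<forall>i\<in>{0..<j}. - real N \<noteq> - real i"
    using assms by auto
  then have "(\<Sum>i=0..j. pochhammer (- real n) i * pochhammer (- real j) i /
      (fact i * pochhammer (- real N) i)) =
      pochhammer (- real N + real n) j / pochhammer (- real N) j"
    using Vandermonde_pochhammer[of j "- real N" "- real n"] by simp
  moreover have "pochhammer (- real j) i / fact i = (-1) ^ i * real (j choose i)" for i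
    by (simp add: binomial_gbinomial gbinomial_pochhammer mult.assoc[symmetric] flip: power_add)
  ultimately show ?thesis
    using assms
    by (simp add: of_nat_diff atMost_atLeast0 field_simps)
qed

text \<open>Both sides are coefficients of \<open>x^k\<close> in the inner identity for fixed
  \<open>i\<close>. After the shift \<open>j = m + i\<close>, the factor depending on
  \<open>i\<close> alone comes out and a Vandermonde convolution remains.\<close>

lemma sum_pochhammer_binomial_gbinomial:
  fixes b :: real
  assumes "i \<le> k"
  shows "(\<Sum>j=i..k. pochhammer b j / fact j * real (j choose i) *
      ((-1) ^ j * ((real k - 1) gchoose (k - j)))) =
    (-1) ^ i * (pochhammer b i / fact i) * (pochhammer (- b) (k - i) / fact (k - i))"
proof -
  have "(\<Sum>j=i..k. pochhammer b j / fact j * real (j choose i) *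
      ((-1) ^ j * ((real k - 1) gchoose (k - j)))) =
    (\<Sum>m=0..k-i. (-1) ^ i * (pochhammer b i / fact i) *
      ((- b - real i gchoose m) * ((real k - 1) gchoose (k - i - m))))"
    (is "?L = (\<Sum>m=0..k-i. ?c * (?u m * ?v m))")
  proof (rule sum.reindex_bij_witness[of _ "\<lambda>m. m + i" "\<lambda>j. j - i"])
    fix j assume j: "j \<in> {i..k}"
    \<comment> \<open>Negating the upper index absorbs the part \<open>(-1)^(j - i)\<close> of the
      sign; \<open>(-1)^i\<close> stays in \<open>?c\<close>.\<close>
    have u: "?u (j - i) = (-1) ^ (j - i) * pochhammer (b + real i) (j - i) / fact (j - i)"
      by (simp add: gbinomial_pochhammer add.commute)
    have sgn: "(-1::real) ^ j = (-1) ^ i * (-1) ^ (j - i)"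
      using j by (simp flip: power_add)
    have poch: "pochhammer b j = pochhammer b i * pochhammer (b + real i) (j - i)"
      using j by (simp add: pochhammer_product)
    have ch: "real (j choose i) / fact j = 1 / (fact i * fact (j - i))"
      using j by (simp add: binomial_fact)
    have "pochhammer b j / fact j * real (j choose i) = pochhammer b j * (real (j choose i) / fact j)"
      by simp
    also have "\<dots> = pochhammer b i * pochhammer (b + real i) (j - i) / (fact i * fact (j - i))"
      unfolding ch poch by simp
    finally show "?c * (?u (j - i) * ?v (j - i)) = pochhammer b j / fact j * real (j choose i) *
        ((-1) ^ j * ((real k - 1) gchoose (k - j)))"
      using j by (simp add: u sgn)
  qed (use assms in auto)
  also have "\<dots> = ?c * ((- b - real i + (real k - 1)) gchoose (k - i))"
    by (simp only: sum_distrib_left[symmetric] gbinomial_Vandermonde)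
  \<comment> \<open>The upper index equals \<open>- b + (k - i) - 1\<close>, the top factor of
    \<open>pochhammer (- b) (k - i)\<close>.\<close>
  also have "(- b - real i + (real k - 1)) gchoose (k - i) = pochhammer (- b) (k - i) / fact (k - i)"
    using assms by (simp add: gbinomial_pochhammer' of_nat_diff)
  finally show ?thesis .
qed

theorem propositionB2:
  fixes N n :: nat and b :: real
  assumes "0 < n" and "n < N" and "b \<notin> \<int>"
  shows "\<forall>k\<le>N.
    fps_nth (fps_one_minus_powr b * fps_of_poly (hyp2F1_poly n b N)) k =
    fps_nth (fps_compose (fps_of_poly (hyp2F1_poly (N - n) b N)) (fps_X / (fps_X - 1))) k"
proof (intro allI impI)
  fix k assume k: "k \<le> N"
  define r where "r i = pochhammer (- real n) i / pochhammer (- real N) i" for i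
  define y where "y j = (-1) ^ j * ((real k - 1) gchoose (k - j))" for j
  have "fps_nth (fps_compose (fps_of_poly (hyp2F1_poly (N - n) b N)) (fps_X / (fps_X - 1))) k =
      (\<Sum>j\<le>k. pochhammer (- real (N - n)) j / pochhammer (- real N) j *
        (pochhammer b j / fact j * y j))"
    unfolding fps_compose_nth atMost_atLeast0
    by (rule sum.cong) (simp_all add: fps_nth_X_div_X_minus_1_power coeff_hyp2F1_poly y_def)
  also have "\<dots> = (\<Sum>j\<le>k. \<Sum>i\<le>j. (-1) ^ i * r i *
      (pochhammer b j / fact j * real (j choose i) * y j))"
  proof (intro sum.cong refl)
    fix j assume "j \<in> {..k}"
    then have "pochhammer (- real (N - n)) j / pochhammer (- real N) j =
        (\<Sum>i\<le>j. (-1) ^ i * real (j choose i) * r i)"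
      unfolding r_def using k assms(2) by (intro pochhammer_diff_div_pochhammer) auto
    then show "pochhammer (- real (N - n)) j / pochhammer (- real N) j *
        (pochhammer b j / fact j * y j) =
      (\<Sum>i\<le>j. (-1) ^ i * r i * (pochhammer b j / fact j * real (j choose i) * y j))"
      by (simp only: sum_distrib_right) (simp add: mult_ac)
  qed
  \<comment> \<open>Both double sums run over the triangle \<open>i \<le> j \<le> k\<close>.\<close>
  also have "\<dots> = (\<Sum>i\<le>k. \<Sum>j=i..k. (-1) ^ i * r i *
      (pochhammer b j / fact j * real (j choose i) * y j))"
    unfolding sum.Sigma[OF finite_atMost ballI[OF finite_atMost]]
      sum.Sigma[OF finite_atMost ballI[OF finite_atLeastAtMost]]
    by (rule sum.reindex_bij_witness[of _ prod.swap prod.swap]) auto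
  also have "\<dots> = (\<Sum>i\<le>k. (-1) ^ i * r i *
      ((-1) ^ i * (pochhammer b i / fact i) * (pochhammer (- b) (k - i) / fact (k - i))))"
    by (intro sum.cong refl)
      (simp only: sum_distrib_left[symmetric] y_def atMost_iff sum_pochhammer_binomial_gbinomial)
  \<comment> \<open>The two signs \<open>(-1)^i\<close> cancel, which leaves a Cauchy
    product.\<close>
  also have "\<dots> = (\<Sum>i\<le>k. r i * (pochhammer b i / fact i) *
      (pochhammer (- b) (k - i) / fact (k - i)))"
    by (intro sum.cong refl) (simp add: mult_ac flip: power_mult_distrib)
  also have "\<dots> = fps_nth (fps_of_poly (hyp2F1_poly n b N) * fps_one_minus_powr b) k"
    by (simp add: fps_mult_nth coeff_hyp2F1_poly fps_one_minus_powr_def r_def atMost_atLeast0)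
  finally show "fps_nth (fps_one_minus_powr b * fps_of_poly (hyp2F1_poly n b N)) k =
      fps_nth (fps_compose (fps_of_poly (hyp2F1_poly (N - n) b N)) (fps_X / (fps_X - 1))) k"
    by (simp add: mult.commute)
qed

end
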